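(* Let $(X,\rho)$ be a proper locally compact metric space, let $\mathscr H$ and $\mathscr K$ be Hilbert $X$-modules, let $\mathrm d:\mathcal D(\mathrm d)\subset\mathscr H\to\mathscr K$ be a closed densely defined first order operator, and let $\Delta=\mathrm d^*\mathrm d$. Then the operator $\mathrm d(\Delta+1)^{-1}\in\mathcal B(\mathscr H,\mathscr K)$ is decay preserving.
   Context: A locally compact metric space is proper if it is not compact but its closed balls are compact. A Hilbert $X$-module is a Hilbert space $\mathscr H$ with a $*$-morphism $Q:C_0(X)\to\mathcal B(\mathscr H)$, written $\varphi(Q)$, such that the linear span of the vectors $\varphi(Q)u$ is dense; its multiplier algebra is $\mathcal M(\mathscr H)=\{\varphi(Q):\varphi\in C_0(X)\}$. The morphism $Q$ extends canonically to bounded continuous (indeed bounded Borel) functions, with $\varphi_n(Q)\to\varphi(Q)$ strongly if $\varphi_n$ is bounded and converges pointwise to $\varphi$. A closed densely defined operator $\mathrm d$ from $\mathscr H$ to $\mathscr K$ is a first order operator if there is $C\in\mathbb R$ such that for each bounded Lipschitz function $\varphi$ on $X$ $$|\langle\mathrm d^*u,\varphi(Q)v\rangle_{\mathscr H}-\langle u,\varphi(Q)\mathrm dv\rangle_{\mathscr K}|\le C\,\mathrm{Lip}\,\varphi\,\|u\|_{\mathscr K}\|v\|_{\mathscr H}$$ for all $u\in\mathcal D(\mathrm d^* )$, $v\in\mathcal D(\mathrm d)$, where $\mathrm{Lip}\,\varphi=\sup_{x\ne y}|\varphi(x)-\varphi(y)|\rho(x,y)^{-1}$. $S\in\mathcal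 B(\mathscr H,\mathscr K)$ is decay preserving if for every $M\in\mathcal M(\mathscr H)$ the operator $SM$ belongs to the norm-closed linear span of $\{NT:N\in\mathcal M(\mathscr K),T\in\mathcal B(\mathscr H,\mathscr K)\}$, and for every $N\in\mathcal M(\mathscr K)$ the operator $NS$ belongs to the norm-closed linear span of $\{TM:M\in\mathcal M(\mathscr H),T\in\mathcal B(\mathscr H,\mathscr K)\}$. *)

theory Defs
  imports "HOL-Analysis.Analysis"
begin

section \<open>Complex vector spaces and Hilbert spaces\<close>

text \<open>
  Hilbert spaces are complex, and inner products are conjugate linear in the first argument.
\<close>

class complex_vector = real_vector +
  fixes scaleC :: "complex \<Rightarrow> 'a \<Rightarrow> 'a" (infixr "*\<^sub>C" 75)
  assumes scaleC_add_right: "a *\<^sub>C (x + y) = a *\<^sub>C x + a *\<^sub>C y"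
    and scaleC_add_left: "(a + b) *\<^sub>C x = a *\<^sub>C x + b *\<^sub>C x"
    and scaleC_scaleC: "a *\<^sub>C b *\<^sub>C x = (a * b) *\<^sub>C x"
    and scaleC_one: "1 *\<^sub>C x = x"
    and scaleR_scaleC: "r *\<^sub>R x = complex_of_real r *\<^sub>C x"

global_interpretation complex_vector: vector_space "scaleC :: complex \<Rightarrow> 'a \<Rightarrow> 'a::complex_vector"
  defines csubspace_raw_def: csubspace = complex_vector.subspace
    and cspan_raw_def: cspan = complex_vector.span
  by unfold_locales (simp_all add: scaleC_add_right scaleC_add_left scaleC_scaleC scaleC_one)

class complex_hilbert = complex_vector + banach +
  fixes cinner :: "'a \<Rightarrow> 'a \<Rightarrow> complex"
  assumes cinner_commute: "cinner x y = cnj (cinner y x)"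
    and cinner_add_right: "cinner x (y + z) = cinner x y + cinner x z"
    and cinner_scaleC_right: "cinner x (c *\<^sub>C y) = c * cinner x y"
    and cinner_self: "cinner x x = complex_of_real ((norm x)\<^sup>2)"

lemma norm_scaleC: "norm (c *\<^sub>C x) = norm c * norm (x :: 'a::complex_hilbert)"
proof -
  have "cinner (c *\<^sub>C x) (c *\<^sub>C x) = c * cnj c * cinner x x"
    by (subst cinner_scaleC_right, subst cinner_commute, subst cinner_scaleC_right)
      (simp add: cinner_self)
  hence "complex_of_real ((norm (c *\<^sub>C x))\<^sup>2) = complex_of_real ((norm c * norm x)\<^sup>2)"
    by (simp add: cinner_self complex_mult_cnj cmod_power2 power_mult_distrib)
  hence "(norm (c *\<^sub>C x))\<^sup>2 = (norm c * norm x)\<^sup>2"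
    using of_real_eq_iff by blast
  thus ?thesis
    by (simp add: power2_eq_iff_nonneg)
qed

lemma bounded_linear_scaleC: "bounded_linear (\<lambda>x :: 'a::complex_hilbert. c *\<^sub>C x)"
  by (rule bounded_linear_intro[where K = "norm c"])
    (simp_all add: scaleC_add_right scaleR_scaleC scaleC_scaleC norm_scaleC mult.commute)

instantiation blinfun :: (real_normed_vector, complex_hilbert) complex_vector
begin

lift_definition scaleC_blinfun :: "complex \<Rightarrow> ('a \<Rightarrow>\<^sub>L 'b) \<Rightarrow> 'a \<Rightarrow>\<^sub>L 'b"
  is "\<lambda>c T x. c *\<^sub>C T x"
  by (rule bounded_linear_compose[OF bounded_linear_scaleC])

instance
  by standard (transfer, simp add: fun_eq_iff scaleC_add_right scaleC_add_left scaleC_scaleC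
      scaleC_one scaleR_scaleC)+

end

text \<open>
  The type \<^typ>\<open>'h \<Rightarrow>\<^sub>L 'k\<close> consists of the bounded real-linear maps with the operator norm;
  the bounded operators between complex Hilbert spaces are the complex-linear ones among them.
\<close>

definition bounded_ops :: "('h::complex_hilbert \<Rightarrow>\<^sub>L 'k::complex_hilbert) set" where
  "bounded_ops = {T. \<forall>c u. blinfun_apply T (c *\<^sub>C u) = c *\<^sub>C blinfun_apply T u}"

section \<open>Hilbert modules over a proper metric space\<close>

text \<open>The space is the whole type \<open>'x\<close>.\<close>

definition proper_metric_space :: "'x::metric_space itself \<Rightarrow> bool" where
  "proper_metric_space _ \<longleftrightarrow>
     locally compact (UNIV :: 'x set) \<and> \<not> compact (UNIV :: 'x set) \<and>
     (\<forall>(x::'x) r. compact (cball x r))"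

definition C0 :: "('x::metric_space \<Rightarrow> complex) set" where
  "C0 = {\<phi>. continuous_on UNIV \<phi> \<and> (\<forall>e>0. \<exists>K. compact K \<and> (\<forall>x. x \<notin> K \<longrightarrow> norm (\<phi> x) < e))}"

text \<open>The values of \<open>Q\<close> outside \<^const>\<open>C0\<close> are irrelevant.\<close>

definition hilbert_module ::
  "(('x::metric_space \<Rightarrow> complex) \<Rightarrow> ('h::complex_hilbert \<Rightarrow>\<^sub>L 'h)) \<Rightarrow> bool" where
  "hilbert_module Q \<longleftrightarrow>
     (\<forall>\<phi>\<in>C0. Q \<phi> \<in> bounded_ops) \<and>
     (\<forall>\<phi>\<in>C0. \<forall>\<psi>\<in>C0. Q (\<lambda>x. \<phi> x + \<psi> x) = Q \<phi> + Q \<psi>) \<and>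
     (\<forall>c. \<forall>\<phi>\<in>C0. Q (\<lambda>x. c * \<phi> x) = c *\<^sub>C Q \<phi>) \<and>
     (\<forall>\<phi>\<in>C0. \<forall>\<psi>\<in>C0. Q (\<lambda>x. \<phi> x * \<psi> x) = Q \<phi> o\<^sub>L Q \<psi>) \<and>
     (\<forall>\<phi>\<in>C0. \<forall>u v. cinner (Q (\<lambda>x. cnj (\<phi> x)) u) v = cinner u (Q \<phi> v)) \<and>
     closure (cspan {Q \<phi> u |\<phi> u. \<phi> \<in> C0}) = UNIV"

definition multiplier_algebra ::
  "(('x::metric_space \<Rightarrow> complex) \<Rightarrow> ('h::complex_hilbert \<Rightarrow>\<^sub>L 'h)) \<Rightarrow> ('h \<Rightarrow>\<^sub>L 'h) set" where
  "multiplier_algebra Q = Q ` C0"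

text \<open>
  Canonical extension of \<open>Q\<close> to bounded continuous functions: \<open>\<phi>(Q)\<close> is the bounded operator
  with \<open>\<phi>(Q) \<psi>(Q) = (\<phi>\<psi>)(Q)\<close> for all \<open>\<psi> \<in> C\<^sub>0(X)\<close>. For a Hilbert module it exists and
  is unique, because the vectors \<open>\<psi>(Q)u\<close> span a dense subspace and \<open>C\<^sub>0(X)\<close> has a bounded
  approximate unit.
\<close>

definition module_ext ::
  "(('x::metric_space \<Rightarrow> complex) \<Rightarrow> ('h::complex_hilbert \<Rightarrow>\<^sub>L 'h)) \<Rightarrow>
     ('x \<Rightarrow> complex) \<Rightarrow> ('h \<Rightarrow>\<^sub>L 'h)" where
  "module_ext Q \<phi> =
     (THE T. T \<in> bounded_ops \<and> (\<forall>\<psi>\<in>C0. T o\<^sub>L Q \<psi> = Q (\<lambda>x. \<phi> x * \<psi> x)))"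

section \<open>Unbounded operators\<close>

text \<open>
  An unbounded operator is given by its domain \<open>D\<close> and a function \<open>d\<close> whose values outside
  \<open>D\<close> are irrelevant.
\<close>

definition closed_densely_defined ::
  "'h::complex_hilbert set \<Rightarrow> ('h \<Rightarrow> 'k::complex_hilbert) \<Rightarrow> bool" where
  "closed_densely_defined D d \<longleftrightarrow>
     csubspace D \<and>
     (\<forall>u\<in>D. \<forall>v\<in>D. d (u + v) = d u + d v) \<and>
     (\<forall>c. \<forall>v\<in>D. d (c *\<^sub>C v) = c *\<^sub>C d v) \<and>
     closure D = UNIV \<and>
     closed {(v, d v) |v. v \<in> D}"

definition adj_dom ::
  "'h::complex_hilbert set \<Rightarrow> ('h \<Rightarrow> 'k::complex_hilbert) \<Rightarrow> 'k set" where
  "adj_dom D d = {u. \<exists>w. \<forall>v\<in>D. cinner w v = cinner u (d v)}"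

definition adj ::
  "'h::complex_hilbert set \<Rightarrow> ('h \<Rightarrow> 'k::complex_hilbert) \<Rightarrow> 'k \<Rightarrow> 'h" where
  "adj D d u = (THE w. \<forall>v\<in>D. cinner w v = cinner u (d v))"

text \<open>The operator \<open>\<Delta> = d\<^sup>* d\<close> with its natural domain.\<close>

definition laplace_dom ::
  "'h::complex_hilbert set \<Rightarrow> ('h \<Rightarrow> 'k::complex_hilbert) \<Rightarrow> 'h set" where
  "laplace_dom D d = {v \<in> D. d v \<in> adj_dom D d}"

definition laplace ::
  "'h::complex_hilbert set \<Rightarrow> ('h \<Rightarrow> 'k::complex_hilbert) \<Rightarrow> 'h \<Rightarrow> 'h" where
  "laplace D d v = adj D d (d v)"

section \<open>First order and decay preserving operators\<close>

definition bounded_lipschitz :: "('x::metric_space \<Rightarrow> complex) set" where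
  "bounded_lipschitz = {\<phi>. bounded (range \<phi>) \<and> (\<exists>L. L-lipschitz_on UNIV \<phi>)}"

definition Lip :: "('x::metric_space \<Rightarrow> complex) \<Rightarrow> real" where
  "Lip \<phi> = Sup {norm (\<phi> x - \<phi> y) / dist x y |x y. x \<noteq> y}"

definition first_order ::
  "(('x::metric_space \<Rightarrow> complex) \<Rightarrow> ('h::complex_hilbert \<Rightarrow>\<^sub>L 'h)) \<Rightarrow>
   (('x \<Rightarrow> complex) \<Rightarrow> ('k::complex_hilbert \<Rightarrow>\<^sub>L 'k)) \<Rightarrow>
   'h set \<Rightarrow> ('h \<Rightarrow> 'k) \<Rightarrow> bool" where
  "first_order QH QK D d \<longleftrightarrow>
     closed_densely_defined D d \<and>
     (\<exists>C::real. \<forall>\<phi>\<in>bounded_lipschitz. \<forall>u\<in>adj_dom D d. \<forall>v\<in>D.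
        norm (cinner (adj D d u) (module_ext QH \<phi> v) - cinner u (module_ext QK \<phi> (d v)))
          \<le> C * Lip \<phi> * norm u * norm v)"

definition decay_preserving ::
  "(('x::metric_space \<Rightarrow> complex) \<Rightarrow> ('h::complex_hilbert \<Rightarrow>\<^sub>L 'h)) \<Rightarrow>
   (('x \<Rightarrow> complex) \<Rightarrow> ('k::complex_hilbert \<Rightarrow>\<^sub>L 'k)) \<Rightarrow>
   ('h \<Rightarrow>\<^sub>L 'k) \<Rightarrow> bool" where
  "decay_preserving QH QK S \<longleftrightarrow>
     (\<forall>M\<in>multiplier_algebra QH.
        S o\<^sub>L M \<in> closure (cspan {N o\<^sub>L T |N T. N \<in> multiplier_algebra QK \<and> T \<in> bounded_ops})) \<and>
     (\<forall>N\<in>multiplier_algebra QK.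
        N o\<^sub>L S \<in> closure (cspan {T o\<^sub>L M |T M. T \<in> bounded_ops \<and> M \<in> multiplier_algebra QH}))"

end

theory Submission
  imports Defs
begin

text \<open>
  If \<open>\<kappa> \<in> C\<^sub>0(X)\<close> is real and Lipschitz, the first order condition and \<open>d\<^sup>*\<^sup>* = d\<close> show that \<open>\<kappa>(Q)\<close>
  preserves the domain of \<open>d\<close> and that \<open>[d, \<kappa>(Q)]\<close> is bounded by \<open>C Lip \<kappa>\<close>. Testing the weak equation
  for \<open>z = (\<Delta> + 1)\<^sup>-\<^sup>1 \<kappa>(Q) f - \<kappa>(Q) (\<Delta> + 1)\<^sup>-\<^sup>1 f\<close> against \<open>z\<close> itself bounds the commutator of \<open>\<kappa>(Q)\<close>
  with \<open>S = d (\<Delta> + 1)\<^sup>-\<^sup>1\<close> by \<open>3 C Lip \<kappa>\<close>. Balls of \<open>X\<close> being compact, there are such \<open>\<kappa>\<close> with \<open>Lip \<kappa>\<close>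
  arbitrarily small and \<open>\<kappa> = 1\<close> on a given compact set, so that \<open>\<kappa>(Q) S \<phi>(Q)\<close> approximates
  \<open>S \<kappa>(Q) \<phi>(Q)\<close> and hence \<open>S \<phi>(Q)\<close> in norm; likewise for \<open>\<phi>(Q) S\<close>.
\<close>

section \<open>Inner product estimates and Riesz representation on a subspace\<close>

lemma cinner_add_left:
  fixes x :: "'a::complex_hilbert"
  shows "cinner (x + y) z = cinner x z + cinner y z"
  by (metis cinner_commute cinner_add_right complex_cnj_add)

lemma cinner_scaleC_left:
  fixes x :: "'a::complex_hilbert"
  shows "cinner (c *\<^sub>C x) y = cnj c * cinner x y"
  by (metis cinner_commute cinner_scaleC_right complex_cnj_mult)

lemma norm_add_sq:
  fixes x :: "'a::complex_hilbert"
  shows "(norm (x + y))\<^sup>2 = (norm x)\<^sup>2 + 2 * Re (cinner x y) + (norm y)\<^sup>2"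
proof -
  have "complex_of_real ((norm (x + y))\<^sup>2)
      = complex_of_real ((norm x)\<^sup>2) + (cinner x y + cnj (cinner x y)) + complex_of_real ((norm y)\<^sup>2)"
    unfolding cinner_self[symmetric] cinner_commute[of y x, symmetric]
    by (simp add: cinner_add_left cinner_add_right)
  from arg_cong[OF this, of Re] show ?thesis
    by simp
qed

text \<open>The triangle inequality comes with the norm; squaring and expanding it leaves exactly
  this estimate.\<close>

lemma Re_cinner_le:
  fixes x :: "'a::complex_hilbert"
  shows "Re (cinner x y) \<le> norm x * norm y"
proof -
  have "(norm (x + y))\<^sup>2 \<le> (norm x + norm y)\<^sup>2"
    by (simp add: norm_triangle_ineq power_mono)
  thus ?thesis
    unfolding norm_add_sq by (simp add: power2_sum)
qed

text \<open>\<open>Re_cinner_le\<close> is applied to \<open>x\<close> and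
  \<open>cnj ?c *\<^sub>C y\<close>: the factor \<open>cnj ?c\<close> turns the inner product into
  the nonnegative real |?c|^2.\<close>

lemma cinner_Cauchy_Schwarz:
  fixes x :: "'a::complex_hilbert"
  shows "norm (cinner x y) \<le> norm x * norm y"
proof (cases "cinner x y = 0")
  case False
  let ?c = "cinner x y"
  have "(norm ?c)\<^sup>2 = Re (cinner x (cnj ?c *\<^sub>C y))"
    by (simp add: cinner_scaleC_right cmod_power2 flip: power2_eq_square)
  also have "\<dots> \<le> norm x * (norm ?c * norm y)"
    using Re_cinner_le[of x "cnj ?c *\<^sub>C y"] by (simp add: norm_scaleC)
  finally have "norm ?c * norm ?c \<le> norm ?c * (norm x * norm y)"
    by (simp add: power2_eq_square ac_simps)
  thus ?thesis
    using False by (simp add: mult_le_cancel_left)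
qed simp

text \<open>Supplies continuity and the rules for differences, such as \<open>cinner.tendsto\<close>
  and \<open>cinner.diff_left\<close>.\<close>

lemma bounded_bilinear_cinner:
  "bounded_bilinear (cinner :: 'a \<Rightarrow> 'a \<Rightarrow> complex)" for dummy :: "'a::complex_hilbert"
proof
  fix r :: real and x y z :: 'a
  show "cinner (r *\<^sub>R x) y = r *\<^sub>R cinner x y"
    by (simp add: scaleR_scaleC cinner_scaleC_left scaleR_conv_of_real)
  show "cinner x (r *\<^sub>R y) = r *\<^sub>R cinner x y"
    by (simp add: scaleR_scaleC cinner_scaleC_right scaleR_conv_of_real)
  show "\<exists>K. \<forall>(x::'a) y. norm (cinner x y) \<le> norm x * norm y * K"
    using cinner_Cauchy_Schwarz by (intro exI[of _ 1]) auto
qed (simp_all add: cinner_add_left cinner_add_right)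

interpretation cinner: bounded_bilinear "cinner :: 'a \<Rightarrow> 'a \<Rightarrow> complex"
  for dummy :: "'a::complex_hilbert"
  by (rule bounded_bilinear_cinner)

lemma norm_diff_sq:
  fixes x :: "'a::complex_hilbert"
  shows "(norm (x - y))\<^sup>2 = (norm x)\<^sup>2 - 2 * Re (cinner x y) + (norm y)\<^sup>2"
  using norm_add_sq[of x "- y"] by (simp add: cinner.minus_right)

text \<open>The functional \<open>\<parallel>u\<parallel>\<^sup>2 - 2 Re \<beta>(u)\<close> is minimized over \<open>V\<close>. Its minimizing sequences are Cauchy by
  the parallelogram identity, even if \<open>V\<close> is not closed.\<close>

lemma Riesz_subspace:
  fixes V :: "'a::complex_hilbert set" and \<beta> :: "'a \<Rightarrow> complex"
  assumes V: "csubspace V"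
    and add: "\<And>u v. u \<in> V \<Longrightarrow> v \<in> V \<Longrightarrow> \<beta> (u + v) = \<beta> u + \<beta> v"
    and scale: "\<And>c u. u \<in> V \<Longrightarrow> \<beta> (c *\<^sub>C u) = c * \<beta> u"
    and bound: "\<And>u. u \<in> V \<Longrightarrow> norm (\<beta> u) \<le> M * norm u"
  obtains q where "q \<in> closure V" "\<And>u. u \<in> V \<Longrightarrow> cinner q u = \<beta> u" "norm q \<le> \<bar>M\<bar>"
proof -
  define J where "J u = (norm u)\<^sup>2 - 2 * Re (\<beta> u)" for u
  define m where "m = Inf (J ` V)"
  note V_add = complex_vector.subspace_add[OF V] and V_scale = complex_vector.subspace_scale[OF V]
  have V0: "0 \<in> V"
    by (rule complex_vector.subspace_0[OF V])
  have scaleR: "t *\<^sub>R u \<in> V" "Re (\<beta> (t *\<^sub>R u)) = t * Re (\<beta> u)" if "u \<in> V" for t u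
    using V_scale[OF that] scale[OF that] by (simp_all add: scaleR_scaleC)
  \<comment> \<open>Completing the square: |u|^2 - 2 M |u| \<ge> - M^2.\<close>
  have "- M\<^sup>2 \<le> J u" if "u \<in> V" for u
  proof -
    have "Re (\<beta> u) \<le> M * norm u"
      using bound[OF that] complex_Re_le_cmod order_trans by blast
    moreover have "0 \<le> (norm u - M)\<^sup>2"
      by simp
    ultimately show ?thesis
      unfolding J_def power2_diff by (simp add: algebra_simps)
  qed
  hence "bdd_below (J ` V)"
    by (intro bdd_belowI2)
  hence m_le: "m \<le> J u" if "u \<in> V" for u
    unfolding m_def using that by (rule cINF_lower)
  have "\<exists>u\<in>V. J u < m + inverse (real (Suc n))" for n
    using cInf_lessD[of "J ` V" "m + inverse (real (Suc n))"] V0 unfolding m_def by auto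
  then obtain s where s: "\<And>n. s n \<in> V" "\<And>n. J (s n) < m + inverse (real (Suc n))"
    by metis
  \<comment> \<open>The midpoint of \<open>u\<close> and \<open>v\<close> lies in \<open>V\<close>,
    so \<open>m\<close> bounds \<open>J\<close> there from below; the parallelogram identity turns
    this into a bound on the distance.\<close>
  have par: "(norm (u - v))\<^sup>2 \<le> 2 * J u + 2 * J v - 4 * m" if "u \<in> V" "v \<in> V" for u v
  proof -
    have "m \<le> J ((1/2) *\<^sub>R (u + v))"
      by (intro m_le scaleR V_add that)
    also have "4 * \<dots> = (norm (u + v))\<^sup>2 - 4 * Re (\<beta> u) - 4 * Re (\<beta> v)"
    proof -
      have "Re (\<beta> ((1/2) *\<^sub>R (u + v))) = 1/2 * (Re (\<beta> u) + Re (\<beta> v))"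
        using scaleR(2)[OF V_add[OF that], of "1/2"] add[OF that] by simp
      moreover have "(norm ((1/2) *\<^sub>R (u + v)))\<^sup>2 = 1/4 * (norm (u + v))\<^sup>2"
        unfolding norm_scaleR power_mult_distrib by (simp add: power2_eq_square)
      ultimately show ?thesis
        unfolding J_def by simp
    qed
    finally show ?thesis
      unfolding norm_add_sq norm_diff_sq J_def by simp
  qed
  have "Cauchy s"
  proof (rule CauchyI)
    fix e :: real assume "0 < e"
    then obtain N where N: "inverse (real (Suc N)) < e\<^sup>2 / 4"
      using reals_Archimedean[of "e\<^sup>2 / 4"] by auto
    have "norm (s a - s b) < e" if "a \<ge> N" "b \<ge> N" for a b
    proof -
      have "inverse (real (Suc a)) \<le> inverse (real (Suc N))"
        "inverse (real (Suc b)) \<le> inverse (real (Suc N))"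
        using that by (auto intro!: le_imp_inverse_le)
      hence "(norm (s a - s b))\<^sup>2 < e\<^sup>2"
        using par[OF s(1) s(1), of a b] s(2)[of a] s(2)[of b] N by linarith
      thus ?thesis
        using \<open>0 < e\<close> by (intro power_less_imp_less_base[of _ 2 e]) auto
    qed
    thus "\<exists>M. \<forall>m\<ge>M. \<forall>n\<ge>M. norm (s m - s n) < e"
      by blast
  qed
  then obtain q where q: "s \<longlonglongrightarrow> q"
    using Cauchy_convergent convergent_def by blast
  \<comment> \<open>The limit \<open>q\<close> may lie outside \<open>V\<close>, where nothing is
    known about \<open>\<beta>\<close>. So the variation is made at \<open>s n \<in> V\<close>, and
    the limit is taken afterwards.\<close>
  have var: "0 \<le> 2 * t * (Re (cinner q w) - Re (\<beta> w)) + t\<^sup>2 * (norm w)\<^sup>2" if "w \<in> V" for w and t :: real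
  proof -
    have nonneg: "0 \<le> inverse (real (Suc n)) + 2 * t * (Re (cinner (s n) w) - Re (\<beta> w)) + t\<^sup>2 * (norm w)\<^sup>2" for n
    proof -
      have "m \<le> J (s n + t *\<^sub>R w)"
        by (intro m_le V_add s scaleR that)
      also have "\<dots> = J (s n) + 2 * t * (Re (cinner (s n) w) - Re (\<beta> w)) + t\<^sup>2 * (norm w)\<^sup>2"
        using scaleR[OF that, of t] add[OF s(1)[of n], of "t *\<^sub>R w"]
        by (simp add: J_def norm_add_sq cinner.scaleR_right power_mult_distrib algebra_simps)
      finally show ?thesis
        using s(2)[of n] by linarith
    qed
    have lim: "(\<lambda>n. inverse (real (Suc n)) + 2 * t * (Re (cinner (s n) w) - Re (\<beta> w)) + t\<^sup>2 * (norm w)\<^sup>2)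
        \<longlonglongrightarrow> 0 + 2 * t * (Re (cinner q w) - Re (\<beta> w)) + t\<^sup>2 * (norm w)\<^sup>2"
      by (intro tendsto_intros LIMSEQ_inverse_real_of_nat cinner.tendsto q)
    have "0 \<le> 0 + 2 * t * (Re (cinner q w) - Re (\<beta> w)) + t\<^sup>2 * (norm w)\<^sup>2"
      by (rule LIMSEQ_le_const[OF lim]) (use nonneg in blast)
    thus ?thesis
      by simp
  qed
  have Re_eq: "Re (cinner q w) = Re (\<beta> w)" if "w \<in> V" for w
  proof (rule ccontr)
    define a where "a = Re (cinner q w) - Re (\<beta> w)"
    \<comment> \<open>Adding 1 keeps the denominator positive also for \<open>w = 0\<close>. The
      choice t = - a / N minimizes 2 t a + t^2 N, with value - a^2 / N.\<close>
    define N where "N = (norm w)\<^sup>2 + 1"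
    assume "Re (cinner q w) \<noteq> Re (\<beta> w)"
    hence a: "a\<^sup>2 > 0"
      by (simp add: a_def)
    have N: "N \<ge> 1" "(norm w)\<^sup>2 \<le> N"
      by (simp_all add: N_def)
    have "0 \<le> 2 * (- a / N) * a + (- a / N)\<^sup>2 * (norm w)\<^sup>2"
      using var[OF that, of "- a / N"] by (simp add: a_def)
    also have "\<dots> \<le> 2 * (- a / N) * a + (- a / N)\<^sup>2 * N"
      using N by (intro add_left_mono mult_left_mono) auto
    also have "\<dots> = - a\<^sup>2 / N"
      using N by (simp add: field_simps power2_eq_square)
    also have "\<dots> < 0"
      using a N by simp
    finally show False
      by simp
  qed
  have eq: "cinner q u = \<beta> u" if "u \<in> V" for u
  proof (rule complex_eqI)
    \<comment> \<open>The imaginary part of a number is minus the real part of its product with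
      \<open>\<i>\<close>, and \<open>V\<close> is closed under multiplication by
      \<open>\<i>\<close>.\<close>
    show "Im (cinner q u) = Im (\<beta> u)"
      using Re_eq[OF V_scale[OF that, of \<i>]] scale[OF that, of \<i>] by (simp add: cinner_scaleC_right)
  qed (rule Re_eq[OF that])
  show ?thesis
  proof
    show "q \<in> closure V"
      using q s(1) closure_sequential by blast
    \<comment> \<open>Testing with \<open>s n\<close> and passing to the limit gives |q|^2 \<le> |M|
      |q|. The absolute value covers \<open>V = {0}\<close>, where the bound leaves the sign of
      \<open>M\<close> open.\<close>
    have "norm (cinner q (s n)) \<le> \<bar>M\<bar> * norm (s n)" for n
      unfolding eq[OF s(1)] using bound[OF s(1), of n]
      by (meson abs_ge_self mult_right_mono norm_ge_zero order_trans)
    moreover have "(\<lambda>n. norm (cinner q (s n))) \<longlonglongrightarrow> norm (cinner q q)"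
      "(\<lambda>n. \<bar>M\<bar> * norm (s n)) \<longlonglongrightarrow> \<bar>M\<bar> * norm q"
      by (intro tendsto_intros cinner.tendsto q)+
    ultimately have "norm (cinner q q) \<le> \<bar>M\<bar> * norm q"
      by (meson LIMSEQ_le)
    hence "norm q * norm q \<le> \<bar>M\<bar> * norm q"
      by (simp add: cinner_self power2_eq_square norm_mult)
    thus "norm q \<le> \<bar>M\<bar>"
      by (cases "q = 0") auto
  qed (rule eq)
qed

section \<open>Direct sums of Hilbert spaces\<close>

instantiation prod :: (complex_vector, complex_vector) complex_vector
begin

definition scaleC_prod :: "complex \<Rightarrow> 'a \<times> 'b \<Rightarrow> 'a \<times> 'b" where
  "scaleC_prod c p = (c *\<^sub>C fst p, c *\<^sub>C snd p)"

instance
  by standard (simp_all add: scaleC_prod_def prod_eq_iff scaleC_add_right scaleC_add_left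
      scaleC_scaleC scaleC_one scaleR_scaleC)

end

text \<open>The product norm is already the Euclidean combination of the two norms, so it comes from
  this inner product. The graph of \<open>d\<close> thereby becomes a subspace of a Hilbert
  space.\<close>

instantiation prod :: (complex_hilbert, complex_hilbert) complex_hilbert
begin

definition cinner_prod :: "'a \<times> 'b \<Rightarrow> 'a \<times> 'b \<Rightarrow> complex" where
  "cinner_prod p q = cinner (fst p) (fst q) + cinner (snd p) (snd q)"

instance
proof
  fix p q r :: "'a \<times> 'b" and c
  show "cinner p q = cnj (cinner q p)"
    using cinner_commute[of "fst p" "fst q"] cinner_commute[of "snd p" "snd q"]
    by (simp add: cinner_prod_def)
  show "cinner p (q + r) = cinner p q + cinner p r"
    by (simp add: cinner_prod_def cinner_add_right)
  show "cinner p (c *\<^sub>C q) = c * cinner p q"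
    by (simp add: cinner_prod_def scaleC_prod_def cinner_scaleC_right algebra_simps)
  show "cinner p p = complex_of_real ((norm p)\<^sup>2)"
    by (simp add: cinner_prod_def cinner_self norm_prod_def)
qed

end

section \<open>Closed densely defined operators and their adjoints\<close>

text \<open>Approximating \<open>a\<close> itself by vectors of \<open>V\<close> gives
  \<open>cinner a a = 0\<close>.\<close>

lemma orthogonal_dense_eq_0:
  fixes a :: "'a::complex_hilbert"
  assumes "closure V = UNIV" "\<And>v. v \<in> V \<Longrightarrow> cinner a v = 0"
  shows "a = 0"
proof -
  obtain s where s: "\<And>n. s n \<in> V" "s \<longlonglongrightarrow> a"
    using assms(1) closure_sequential by blast
  have "(\<lambda>n. cinner a (s n)) \<longlonglongrightarrow> cinner a a"
    by (intro cinner.tendsto tendsto_const s)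
  hence "cinner a a = 0"
    using assms(2) s(1) by (simp add: LIMSEQ_const_iff)
  thus ?thesis
    by (simp add: cinner_self)
qed

context
  fixes D :: "'h::complex_hilbert set" and d :: "'h \<Rightarrow> 'k::complex_hilbert"
  assumes cdd: "closed_densely_defined D d"
begin

lemma dom_subspace: "csubspace D"
  and d_add: "u \<in> D \<Longrightarrow> v \<in> D \<Longrightarrow> d (u + v) = d u + d v"
  and d_scaleC: "v \<in> D \<Longrightarrow> d (c *\<^sub>C v) = c *\<^sub>C d v"
  and dom_dense: "closure D = UNIV"
  and graph_closed: "closed {(v, d v) |v. v \<in> D}"
  using cdd unfolding closed_densely_defined_def by blast+

lemma d_diff: "u \<in> D \<Longrightarrow> v \<in> D \<Longrightarrow> d (u - v) = d u - d v"
  using d_add[of "u - v" v] complex_vector.subspace_diff[OF dom_subspace, of u v] by simp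

text \<open>Density of \<open>D\<close> makes \<open>w\<close> unique, so that the definite
  description in \<open>adj\<close> denotes it.\<close>

lemma adjointI:
  assumes "\<And>v. v \<in> D \<Longrightarrow> cinner w v = cinner u (d v)"
  shows "u \<in> adj_dom D d" "adj D d u = w"
proof -
  show "u \<in> adj_dom D d"
    using assms unfolding adj_dom_def by blast
  show "adj D d u = w"
    unfolding adj_def
  proof (rule the_equality)
    fix w' assume "\<forall>v\<in>D. cinner w' v = cinner u (d v)"
    hence "w' - w = 0"
      using assms by (intro orthogonal_dense_eq_0[OF dom_dense]) (simp add: cinner.diff_left)
    thus "w' = w"
      by simp
  qed (use assms in blast)
qed

lemma cinner_adj:
  assumes "u \<in> adj_dom D d" "v \<in> D"
  shows "cinner (adj D d u) v = cinner u (d v)"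
proof -
  from assms(1) obtain w where w: "\<And>v. v \<in> D \<Longrightarrow> cinner w v = cinner u (d v)"
    unfolding adj_dom_def by blast
  from adjointI(2)[OF this] w[OF assms(2)] show ?thesis
    by simp
qed

lemma adj_add:
  assumes "u \<in> adj_dom D d" "v \<in> adj_dom D d"
  shows "u + v \<in> adj_dom D d" "adj D d (u + v) = adj D d u + adj D d v"
  using adjointI[of "adj D d u + adj D d v" "u + v"] assms
  by (simp_all add: cinner_adj cinner_add_left)

lemma adj_scaleC:
  assumes "u \<in> adj_dom D d"
  shows "c *\<^sub>C u \<in> adj_dom D d" "adj D d (c *\<^sub>C u) = c *\<^sub>C adj D d u"
  using adjointI[of "c *\<^sub>C adj D d u" "c *\<^sub>C u"] assms
  by (simp_all add: cinner_adj cinner_scaleC_left)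

lemma adj_dom_subspace: "csubspace (adj_dom D d)"
  unfolding complex_vector.subspace_def
  using adj_add(1) adj_scaleC(1) adjointI(1)[of 0 0]
  by (simp add: cinner.zero_left)

text \<open>Orthogonal projection of \<open>(p, q)\<close> onto the graph.\<close>

lemma graph_projection:
  obtains v where "v \<in> D" "d v - q \<in> adj_dom D d" "adj D d (d v - q) = p - v"
proof -
  define G where "G = {(v, d v) |v. v \<in> D}"
  have sub: "csubspace G"
    unfolding complex_vector.subspace_def
  proof (intro conjI ballI allI)
    have "d 0 = 0"
      using d_scaleC[of 0 0] complex_vector.subspace_0[OF dom_subspace] by simp
    thus "0 \<in> G"
      unfolding G_def zero_prod_def using complex_vector.subspace_0[OF dom_subspace] by force
    show "x + y \<in> G" if "x \<in> G" "y \<in> G" for x y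
      using that complex_vector.subspace_add[OF dom_subspace] unfolding G_def
      by (auto simp: d_add)
    show "c *\<^sub>C x \<in> G" if "x \<in> G" for c x
      using that complex_vector.subspace_scale[OF dom_subspace] unfolding G_def
      by (auto simp: d_scaleC scaleC_prod_def)
  qed
  \<comment> \<open>The vector representing \<open>cinner (p, q)\<close> on the graph is the
    projection; it stays in the graph because the graph is closed.\<close>
  obtain g where g: "g \<in> closure G" "\<And>u. u \<in> G \<Longrightarrow> cinner g u = cinner (p, q) u"
    by (rule Riesz_subspace[OF sub, of "cinner (p, q)" "norm (p, q)"])
      (simp_all add: cinner_add_right cinner_scaleC_right cinner_Cauchy_Schwarz)
  have "closure G = G"
    using graph_closed by (simp add: G_def)
  then obtain v where v: "v \<in> D" "g = (v, d v)"
    using g(1) unfolding G_def by blast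
  \<comment> \<open>Orthogonality of (p, q) - (v, d v) to the graph is the defining relation of the
    adjoint at \<open>d v - q\<close>.\<close>
  have "cinner (p - v) v' = cinner (d v - q) (d v')" if "v' \<in> D" for v'
  proof -
    have "cinner g (v', d v') = cinner (p, q) (v', d v')"
      using that by (intro g(2)) (auto simp: G_def)
    thus ?thesis
      by (simp add: v cinner_prod_def cinner.diff_left algebra_simps)
  qed
  from that[OF v(1) adjointI[OF this]] show ?thesis .
qed

text \<open>This is \<open>d\<^sup>*\<^sup>* = d\<close>.\<close>

lemma biadjoint:
  assumes "\<And>u. u \<in> adj_dom D d \<Longrightarrow> cinner p (adj D d u) = cinner q u"
  shows "p \<in> D" "d p = q"
proof -
  obtain v where v: "v \<in> D" "d v - q \<in> adj_dom D d" "adj D d (d v - q) = p - v"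
    by (rule graph_projection)
  \<comment> \<open>This identity uses that \<open>v\<close> lies in \<open>D\<close>, the next one
    is the assumption at \<open>u = d v - q\<close>. Their difference says that |p - v|^2 + |d v -
    q|^2 = 0.\<close>
  have "cinner v (p - v) = cinner (d v) (d v - q)"
    using cinner_adj[OF v(2,1)] v(3) cinner_commute[of v "p - v"] cinner_commute[of "d v" "d v - q"]
    by simp
  moreover have "cinner p (p - v) = cinner q (d v - q)"
    using assms[OF v(2)] v(3) by simp
  ultimately have "cinner (p - v) (p - v) + cinner (d v - q) (d v - q) = 0"
    by (simp add: cinner.diff_left)
  hence "(norm (p - v))\<^sup>2 + (norm (d v - q))\<^sup>2 = 0"
    unfolding cinner_self of_real_add[symmetric] of_real_eq_0_iff .
  hence "p = v" "d v = q"
    by (simp_all add: sum_power2_eq_zero_iff)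
  thus "p \<in> D" "d p = q"
    using v by simp_all
qed

section \<open>The resolvent of \<Delta>\<close>

lemma laplace_domD:
  assumes "v \<in> laplace_dom D d"
  shows "v \<in> D" "d v \<in> adj_dom D d"
  using assms by (simp_all add: laplace_dom_def)

lemma laplace_add:
  assumes "u \<in> laplace_dom D d" "v \<in> laplace_dom D d"
  shows "u + v \<in> laplace_dom D d" "laplace D d (u + v) = laplace D d u + laplace D d v"
  using assms complex_vector.subspace_add[OF dom_subspace, of u v]
  by (simp_all add: laplace_dom_def laplace_def d_add adj_add)

lemma laplace_scaleC:
  assumes "v \<in> laplace_dom D d"
  shows "c *\<^sub>C v \<in> laplace_dom D d" "laplace D d (c *\<^sub>C v) = c *\<^sub>C laplace D d v"
  using assms complex_vector.subspace_scale[OF dom_subspace, of v c]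
  by (simp_all add: laplace_dom_def laplace_def d_scaleC adj_scaleC)

text \<open>Energy estimate: pairing the equation with \<open>v\<close> gives |d v|^2 + |v|^2 = <f,
  v>, and Cauchy-Schwarz bounds first \<open>v\<close>, then \<open>d v\<close>.\<close>

lemma resolvent_bound:
  assumes v: "v \<in> laplace_dom D d" and f: "laplace D d v + v = f"
  shows "norm v \<le> norm f" "norm (d v) \<le> norm f"
proof -
  have "cinner f v = complex_of_real ((norm (d v))\<^sup>2 + (norm v)\<^sup>2)"
    unfolding f[symmetric] cinner_add_left laplace_def
      cinner_adj[OF laplace_domD(2)[OF v] laplace_domD(1)[OF v]]
    by (simp add: cinner_self)
  hence *: "(norm (d v))\<^sup>2 + (norm v)\<^sup>2 \<le> norm f * norm v"
    using Re_cinner_le[of f v] by simp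
  hence "norm v * norm v \<le> norm f * norm v"
    using zero_le_power2[of "norm (d v)"] unfolding power2_eq_square by linarith
  thus v_le: "norm v \<le> norm f"
    by (cases "v = 0") (simp_all add: mult_le_cancel_right)
  have "(norm (d v))\<^sup>2 \<le> norm f * norm v"
    using * zero_le_power2[of "norm v"] by linarith
  also have "\<dots> \<le> (norm f)\<^sup>2"
    unfolding power2_eq_square using v_le by (intro mult_left_mono) auto
  finally show "norm (d v) \<le> norm f"
    by (rule power2_le_imp_le) simp
qed

text \<open>Injectivity is \<open>resolvent_bound\<close> with right-hand side 0. For surjectivity,
  projecting (f, 0) onto the graph yields \<open>v\<close> with
  \<open>adj D d (d v) = f - v\<close>, which is the equation to be solved.\<close>

lemma bij_laplace_plus_id: "bij_betw (\<lambda>v. laplace D d v + v) (laplace_dom D d) UNIV"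
  unfolding bij_betw_def
proof
  show "inj_on (\<lambda>v. laplace D d v + v) (laplace_dom D d)"
  proof (rule inj_onI)
    fix u v assume uv: "u \<in> laplace_dom D d" "v \<in> laplace_dom D d"
      and eq: "laplace D d u + u = laplace D d v + v"
    let ?w = "u + (- 1) *\<^sub>C v"
    have "laplace D d ?w + ?w = 0"
      unfolding laplace_add(2)[OF uv(1) laplace_scaleC(1)[OF uv(2)]] laplace_scaleC(2)[OF uv(2)]
      using eq by (simp add: algebra_simps)
    from resolvent_bound(1)[OF laplace_add(1)[OF uv(1) laplace_scaleC(1)[OF uv(2)]] this]
    show "u = v"
      by simp
  qed
  show "(\<lambda>v. laplace D d v + v) ` laplace_dom D d = UNIV"
  proof (intro equalityI subset_UNIV subsetI)
    fix f
    obtain v where v: "v \<in> D" "d v - 0 \<in> adj_dom D d" "adj D d (d v - 0) = f - v"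
      by (rule graph_projection)
    show "f \<in> (\<lambda>v. laplace D d v + v) ` laplace_dom D d"
    proof
      show "f = laplace D d v + v" "v \<in> laplace_dom D d"
        using v by (simp_all add: laplace_def laplace_dom_def)
    qed
  qed
qed

definition resolvent :: "'h \<Rightarrow> 'h" where
  "resolvent = inv_into (laplace_dom D d) (\<lambda>v. laplace D d v + v)"

lemma resolvent_in_dom: "resolvent f \<in> laplace_dom D d"
  and laplace_resolvent: "laplace D d (resolvent f) + resolvent f = f"
proof -
  have "f \<in> (\<lambda>v. laplace D d v + v) ` laplace_dom D d"
    using bij_laplace_plus_id by (simp add: bij_betw_def)
  from inv_into_into[OF this] f_inv_into_f[OF this]
  show "resolvent f \<in> laplace_dom D d" "laplace D d (resolvent f) + resolvent f = f"
    by (simp_all add: resolvent_def)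
qed

lemma resolvent_eqI:
  assumes "v \<in> laplace_dom D d" "laplace D d v + v = f"
  shows "resolvent f = v"
  unfolding resolvent_def using bij_betw_inv_into_left[OF bij_laplace_plus_id assms(1)] assms(2)
  by simp

lemma resolvent_add: "resolvent (f + g) = resolvent f + resolvent g"
proof (rule resolvent_eqI)
  have "laplace D d (resolvent f + resolvent g) + (resolvent f + resolvent g)
      = (laplace D d (resolvent f) + resolvent f) + (laplace D d (resolvent g) + resolvent g)"
    by (simp add: laplace_add resolvent_in_dom)
  thus "laplace D d (resolvent f + resolvent g) + (resolvent f + resolvent g) = f + g"
    unfolding laplace_resolvent .
qed (intro laplace_add resolvent_in_dom)

lemma resolvent_scaleC: "resolvent (c *\<^sub>C f) = c *\<^sub>C resolvent f"
proof (rule resolvent_eqI)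
  have "laplace D d (c *\<^sub>C resolvent f) + c *\<^sub>C resolvent f
      = c *\<^sub>C (laplace D d (resolvent f) + resolvent f)"
    by (simp add: laplace_scaleC resolvent_in_dom scaleC_add_right)
  thus "laplace D d (c *\<^sub>C resolvent f) + c *\<^sub>C resolvent f = c *\<^sub>C f"
    unfolding laplace_resolvent .
qed (intro laplace_scaleC resolvent_in_dom)

lemma d_resolvent_operator:
  obtains S where "S \<in> bounded_ops" "\<And>f. blinfun_apply S f = d (resolvent f)"
proof -
  have in_D: "resolvent f \<in> D" for f
    using resolvent_in_dom laplace_domD by blast
  have bound: "norm (d (resolvent f)) \<le> 1 * norm f" for f
    using resolvent_bound(2)[OF resolvent_in_dom laplace_resolvent] by simp
  have "bounded_linear (\<lambda>f. d (resolvent f))"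
    using bound
    by (intro bounded_linear_intro[where K = 1])
      (simp_all add: resolvent_add in_D d_add scaleR_scaleC resolvent_scaleC d_scaleC)
  hence ap: "blinfun_apply (Blinfun (\<lambda>f. d (resolvent f))) f = d (resolvent f)" for f
    by (simp add: bounded_linear_Blinfun_apply)
  show ?thesis
  proof
    show "Blinfun (\<lambda>f. d (resolvent f)) \<in> bounded_ops"
      by (simp add: bounded_ops_def ap resolvent_scaleC in_D d_scaleC)
  qed (rule ap)
qed

section \<open>Commutators with d and with its composition with the resolvent\<close>

text \<open>\<open>A\<close> and \<open>B\<close> stand for \<kappa>(Q) on the two modules,
  symmetric because \<kappa> is real; \<open>comm\<close> is the first order condition, with
  \<open>\<epsilon>\<close> an upper bound for C Lip \<kappa>.\<close>

context
  fixes A :: "'h \<Rightarrow> 'h" and B :: "'k \<Rightarrow> 'k" and \<epsilon> :: real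
  assumes A_sym: "\<And>u v. cinner (A u) v = cinner u (A v)"
    and B_sym: "\<And>u v. cinner (B u) v = cinner u (B v)"
    and comm: "\<And>u v. u \<in> adj_dom D d \<Longrightarrow> v \<in> D \<Longrightarrow>
      norm (cinner (adj D d u) (A v) - cinner u (B (d v))) \<le> \<epsilon> * norm u * norm v"
    and eps: "\<epsilon> \<ge> 0"
begin

text \<open>The form \<open>?\<beta>\<close> is bounded on the domain of the adjoint, so a vector
  \<open>q\<close> of norm at most \<open>\<epsilon> * norm v\<close> represents it. Then
  \<open>biadjoint\<close> applies to \<open>A v\<close> with value
  \<open>q + B (d v)\<close>.\<close>

lemma commutator_on_dom:
  assumes v: "v \<in> D"
  shows "A v \<in> D" "norm (d (A v) - B (d v)) \<le> \<epsilon> * norm v"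
proof -
  let ?\<beta> = "\<lambda>u. cinner (A v) (adj D d u) - cinner (B (d v)) u"
  have "norm (?\<beta> u) \<le> \<epsilon> * norm v * norm u" if "u \<in> adj_dom D d" for u
  proof -
    \<comment> \<open>The form in \<open>comm\<close> is conjugate linear in \<open>u\<close>;
      conjugation makes it linear, as \<open>Riesz_subspace\<close> requires.\<close>
    have "?\<beta> u = cnj (cinner (adj D d u) (A v) - cinner u (B (d v)))"
      using cinner_commute[of "A v"] cinner_commute[of "B (d v)"] by simp
    thus ?thesis
      using comm[OF that v] by (simp add: ac_simps del: complex_cnj_diff)
  qed
  then obtain q where "q \<in> closure (adj_dom D d)"
    and q: "\<And>u. u \<in> adj_dom D d \<Longrightarrow> cinner q u = ?\<beta> u" "norm q \<le> \<bar>\<epsilon> * norm v\<bar>"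
    by (rule Riesz_subspace[OF adj_dom_subspace, of ?\<beta> "\<epsilon> * norm v", rotated 2])
      (simp_all add: adj_add adj_scaleC cinner_add_right cinner_scaleC_right right_diff_distrib)
  have "cinner (A v) (adj D d u) = cinner (q + B (d v)) u" if "u \<in> adj_dom D d" for u
    using q(1)[OF that] by (simp add: cinner_add_left)
  from biadjoint[OF this] q(2) eps show "A v \<in> D" "norm (d (A v) - B (d v)) \<le> \<epsilon> * norm v"
    by simp_all
qed

text \<open>The commutator at \<open>f\<close> equals \<open>d z + b\<close>, where \<open>b\<close>
  is the commutator with \<open>d\<close> at \<open>w\<close>. Here |b| \<le> \<epsilon> |f|, and
  the energy estimate for \<open>z\<close> gives |d z| \<le> 2 \<epsilon> |f|; hence the factor
  3.\<close>

lemma commutator_resolvent: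
  "norm (d (resolvent (A f)) - B (d (resolvent f))) \<le> 3 * \<epsilon> * norm f"
proof -
  define w where "w = resolvent f"
  define w' where "w' = resolvent (A f)"
  define z where "z = w' - A w"
  define b where "b = d (A w) - B (d w)"
  note dom = resolvent_in_dom[of f, folded w_def] resolvent_in_dom[of "A f", folded w'_def]
  note D = laplace_domD(1)[OF dom(1)] laplace_domD(1)[OF dom(2)]
  note adj = laplace_domD(2)[OF dom(1)] laplace_domD(2)[OF dom(2)]
  have w: "adj D d (d w) = f - w" and w': "adj D d (d w') = A f - w'"
    using laplace_resolvent[of f] laplace_resolvent[of "A f"]
    by (simp_all add: w_def w'_def laplace_def algebra_simps)
  have w_le: "norm w \<le> norm f" "norm (d w) \<le> norm f"
    using resolvent_bound[OF dom(1), of f] laplace_resolvent[of f] by (simp_all add: w_def)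
  have b: "norm b \<le> \<epsilon> * norm f"
    using commutator_on_dom(2)[OF D(1)] mult_left_mono[OF w_le(1) eps] by (simp add: b_def)
  have z: "z \<in> D"
    unfolding z_def using D commutator_on_dom(1) complex_vector.subspace_diff[OF dom_subspace] by blast
  have dz: "d z = d w' - B (d w) - b"
    unfolding z_def b_def using d_diff[OF D(2) commutator_on_dom(1)[OF D(1)]] by simp
  define err where "err = cinner (adj D d (d w)) (A z) - cinner (d w) (B (d z))"
  have "norm err \<le> \<epsilon> * norm (d w) * norm z"
    unfolding err_def by (rule comm[OF adj(1) z])
  also have "\<dots> \<le> \<epsilon> * norm f * norm z"
    using w_le eps by (intro mult_right_mono mult_left_mono) auto
  finally have err: "norm err \<le> \<epsilon> * norm f * norm z" .
  \<comment> \<open>By symmetry \<open>B\<close> moves onto \<open>d z\<close>, and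
    \<open>err\<close> is the price of trading \<open>B (d z)\<close> for \<open>A z\<close>. The
    terms with \<open>A f\<close> cancel, and what remains of the others is - <z, z>.\<close>
  have "cinner (d z) (d z) = cinner (d w') (d z) - cinner (B (d w)) (d z) - cinner b (d z)"
    using dz by (metis cinner.diff_left)
  also have "cinner (d w') (d z) = cinner (A f - w') z"
    using cinner_adj[OF adj(2) z] w' by simp
  also have "cinner (B (d w)) (d z) = cinner (A f - A w) z - err"
    unfolding err_def w by (simp add: B_sym cinner.diff_left A_sym)
  finally have "cinner (d z) (d z) + cinner z z = err - cinner b (d z)"
    by (simp add: z_def cinner.diff_left)
  hence "complex_of_real ((norm (d z))\<^sup>2 + (norm z)\<^sup>2) = err - cinner b (d z)"
    by (simp add: cinner_self)
  hence "(norm (d z))\<^sup>2 + (norm z)\<^sup>2 \<le> norm err + norm (cinner b (d z))"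
    by (metis norm_of_real abs_ge_self norm_triangle_ineq4 order_trans)
  also have "norm (cinner b (d z)) \<le> \<epsilon> * norm f * norm (d z)"
    using cinner_Cauchy_Schwarz b by (meson mult_right_mono norm_ge_zero order_trans)
  finally have *: "(norm (d z))\<^sup>2 + (norm z)\<^sup>2 \<le> \<epsilon> * norm f * norm z + \<epsilon> * norm f * norm (d z)"
    using err by simp
  have "norm (d z) \<le> 2 * (\<epsilon> * norm f)"
  proof -
    have e: "\<epsilon> * norm f \<ge> 0"
      using eps by simp
    \<comment> \<open>With t = x - 2 e, the difference x^2 + y^2 - e y - e x equals t^2 + 3 e t + (y
      - e/2)^2 + (2 - 1/4) e^2, which is positive for t > 0.\<close>
    have "x \<le> 2 * e" if "x\<^sup>2 + y\<^sup>2 \<le> e * y + e * x" "e \<ge> 0" for x y e :: real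
    proof (rule ccontr)
      assume "\<not> x \<le> 2 * e"
      hence "0 \<le> 3 * e * (x - 2 * e)" "0 < (x - 2 * e)\<^sup>2"
        using that by auto
      moreover have "0 \<le> (y - e / 2)\<^sup>2"
        by simp
      ultimately have "7 / 4 * e\<^sup>2 < x\<^sup>2 + y\<^sup>2 - (e * y + e * x)"
        unfolding power2_diff by (simp add: power2_eq_square algebra_simps)
      thus False
        using that(1) zero_le_power2[of e] by linarith
    qed
    from this[OF * e] show ?thesis .
  qed
  moreover have "d w' - B (d w) = d z + b"
    using dz by simp
  ultimately show ?thesis
    using norm_triangle_ineq[of "d z" b] b unfolding w_def w'_def by simp
qed

end

end

section \<open>The action of \<open>C0\<close> on a Hilbert module\<close>

lemma C0_dominated:
  assumes "\<phi> \<in> C0" "continuous_on UNIV \<psi>" "\<And>x. norm (\<psi> x) \<le> norm (\<phi> x)"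
  shows "\<psi> \<in> C0"
  unfolding C0_def
proof (intro CollectI conjI allI impI)
  fix e :: real assume "e > 0"
  then obtain K where "compact K" "\<forall>x. x \<notin> K \<longrightarrow> norm (\<phi> x) < e"
    using assms(1) unfolding C0_def by blast
  thus "\<exists>K. compact K \<and> (\<forall>x. x \<notin> K \<longrightarrow> norm (\<psi> x) < e)"
    using assms(3) le_less_trans by blast
qed (rule assms(2))

lemma C0_scale:
  assumes "\<phi> \<in> C0"
  shows "(\<lambda>x. c * \<phi> x) \<in> C0"
proof (cases "c = 0")
  case True
  show ?thesis
    by (rule C0_dominated[OF assms]) (simp_all add: True)
next
  case False
  have "\<exists>K. compact K \<and> (\<forall>x. x \<notin> K \<longrightarrow> norm (c * \<phi> x) < e)" if "e > 0" for e
  proof -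
    have "e / norm c > 0"
      using that False by simp
    then obtain K where "compact K" "\<And>x. x \<notin> K \<Longrightarrow> norm (\<phi> x) < e / norm c"
      using assms unfolding C0_def by blast
    thus ?thesis
      using False by (intro exI[of _ K]) (simp add: norm_mult field_simps)
  qed
  moreover have "continuous_on UNIV (\<lambda>x. c * \<phi> x)"
    using assms by (auto simp: C0_def intro!: continuous_intros)
  ultimately show ?thesis
    by (simp add: C0_def)
qed

context
  fixes Q :: "('x::metric_space \<Rightarrow> complex) \<Rightarrow> ('h::complex_hilbert \<Rightarrow>\<^sub>L 'h)"
  assumes Q: "hilbert_module Q"
begin

lemma Q_bounded_op: "\<phi> \<in> C0 \<Longrightarrow> Q \<phi> \<in> bounded_ops"
  and Q_add: "\<phi> \<in> C0 \<Longrightarrow> \<psi> \<in> C0 \<Longrightarrow> Q (\<lambda>x. \<phi> x + \<psi> x) = Q \<phi> + Q \<psi>"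
  and Q_scale: "\<phi> \<in> C0 \<Longrightarrow> Q (\<lambda>x. c * \<phi> x) = c *\<^sub>C Q \<phi>"
  and Q_mult: "\<phi> \<in> C0 \<Longrightarrow> \<psi> \<in> C0 \<Longrightarrow> Q (\<lambda>x. \<phi> x * \<psi> x) = Q \<phi> o\<^sub>L Q \<psi>"
  and Q_cnj: "\<phi> \<in> C0 \<Longrightarrow> cinner (Q (\<lambda>x. cnj (\<phi> x)) u) v = cinner u (Q \<phi> v)"
  and Q_dense: "closure (cspan {Q \<phi> u |\<phi> u. \<phi> \<in> C0}) = UNIV"
  using Q unfolding hilbert_module_def by blast+

text \<open>With \<open>\<psi> = 1 - sqrt (1 - \<bar>\<phi>\<bar>\<^sup>2)\<close>, which vanishes at infinity, \<open>1 - \<bar>\<phi>\<bar>\<^sup>2 = (1 - \<psi>)\<^sup>2\<close> and hence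
  \<open>\<parallel>u\<parallel>\<^sup>2 - \<parallel>\<phi>(Q)u\<parallel>\<^sup>2 = \<parallel>u - \<psi>(Q)u\<parallel>\<^sup>2\<close>.\<close>

lemma Q_contraction_1:
  assumes \<phi>: "\<phi> \<in> C0" and le: "\<And>x. norm (\<phi> x) \<le> 1"
  shows "norm (Q \<phi> u) \<le> norm u"
proof -
  define \<psi> where "\<psi> x = complex_of_real (1 - sqrt (1 - (norm (\<phi> x))\<^sup>2))" for x
  have cont: "continuous_on UNIV \<phi>"
    using \<phi> by (simp add: C0_def)
  have sq: "(norm (\<phi> x))\<^sup>2 \<le> norm (\<phi> x)" "(norm (\<phi> x))\<^sup>2 \<le> 1" for x
    using le[of x] by (simp_all add: power2_eq_square mult_left_le mult_le_one)
  \<comment> \<open>As 0 \<le> s \<le> 1, also s^2 \<le> s, so 1 - s \<le> 1 - s^2 = |\<phi>|^2.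
    This domination puts \<open>\<psi>\<close> into \<open>C0\<close>.\<close>
  have \<psi>_le: "norm (\<psi> x) \<le> (norm (\<phi> x))\<^sup>2" "norm (\<psi> x) \<le> 1" for x
  proof -
    define s where "s = sqrt (1 - (norm (\<phi> x))\<^sup>2)"
    have s: "0 \<le> s" "s \<le> 1" "s\<^sup>2 = 1 - (norm (\<phi> x))\<^sup>2"
      using sq[of x] by (simp_all add: s_def)
    have "s * s \<le> s"
      using s(1,2) by (simp add: mult_left_le)
    moreover have "norm (\<psi> x) = 1 - s"
      unfolding \<psi>_def s_def[symmetric] norm_of_real using s by simp
    ultimately show "norm (\<psi> x) \<le> (norm (\<phi> x))\<^sup>2" "norm (\<psi> x) \<le> 1"
      using s by (simp_all add: power2_eq_square)
  qed
  have \<psi>: "\<psi> \<in> C0"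
  proof (rule C0_dominated[OF \<phi>])
    show "continuous_on UNIV \<psi>"
      unfolding \<psi>_def by (intro continuous_intros cont)
    show "norm (\<psi> x) \<le> norm (\<phi> x)" for x
      using \<psi>_le(1)[of x] sq(1)[of x] by linarith
  qed
  have \<psi>\<psi>: "(\<lambda>x. \<psi> x * \<psi> x) \<in> C0"
    using \<psi>_le(2) by (intro C0_dominated[OF \<psi>] continuous_intros)
      (use \<psi> in \<open>auto simp: C0_def norm_mult mult_left_le\<close>)
  have cnj\<phi>: "(\<lambda>x. cnj (\<phi> x)) \<in> C0"
    by (intro C0_dominated[OF \<phi>] continuous_intros cont) simp
  have \<phi>\<phi>: "(\<lambda>x. cnj (\<phi> x) * \<phi> x) \<in> C0"
    using le by (intro C0_dominated[OF \<phi>] continuous_intros cont) (simp add: norm_mult mult_left_le_one_le)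
  \<comment> \<open>This is 1 - |\<phi>|^2 = (1 - \<psi>)^2 with the constant cancelled:
    \<open>Q\<close> applies only to functions in \<open>C0\<close>, and 1 need not be one of
    them.\<close>
  have "cnj (\<phi> x) * \<phi> x + \<psi> x * \<psi> x = 2 * \<psi> x" for x
  proof -
    define s where "s = sqrt (1 - (norm (\<phi> x))\<^sup>2)"
    have "s * s = 1 - (norm (\<phi> x))\<^sup>2"
      using sq(2)[of x] by (simp add: s_def)
    hence "(norm (\<phi> x))\<^sup>2 + (1 - s) * (1 - s) = 2 * (1 - s)"
      by (simp add: algebra_simps)
    hence "complex_of_real ((norm (\<phi> x))\<^sup>2) + \<psi> x * \<psi> x = 2 * \<psi> x"
      unfolding \<psi>_def s_def[symmetric] of_real_mult[symmetric] of_real_add[symmetric]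
      by (metis of_real_mult of_real_numeral)
    thus ?thesis
      by (simp only: complex_norm_square mult.commute[of "cnj (\<phi> x)"])
  qed
  hence "(Q (\<lambda>x. cnj (\<phi> x)) o\<^sub>L Q \<phi>) + (Q \<psi> o\<^sub>L Q \<psi>) = 2 *\<^sub>C Q \<psi>"
    using Q_add[OF \<phi>\<phi> \<psi>\<psi>] Q_mult[OF cnj\<phi> \<phi>] Q_mult[OF \<psi> \<psi>] Q_scale[OF \<psi>, of 2] by simp
  from arg_cong[OF this, of "\<lambda>T. blinfun_apply T u"]
  have "Q (\<lambda>x. cnj (\<phi> x)) (Q \<phi> u) + Q \<psi> (Q \<psi> u) = 2 *\<^sub>C Q \<psi> u"
    by (simp add: blinfun.add_left scaleC_blinfun.rep_eq)
  from arg_cong[OF this, of "\<lambda>x. cinner x u"]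
  have "cinner (Q (\<lambda>x. cnj (\<phi> x)) (Q \<phi> u)) u + cinner (Q \<psi> (Q \<psi> u)) u = 2 * cinner (Q \<psi> u) u"
    by (simp add: cinner_add_left cinner_scaleC_left)
  moreover have "cinner (Q \<psi> x) y = cinner x (Q \<psi> y)" for x y
  proof -
    have "(\<lambda>x. cnj (\<psi> x)) = \<psi>"
      by (rule ext) (simp add: \<psi>_def)
    thus ?thesis
      using Q_cnj[OF \<psi>] by simp
  qed
  ultimately have "cinner (Q \<phi> u) (Q \<phi> u) + cinner (Q \<psi> u) (Q \<psi> u) = 2 * cinner u (Q \<psi> u)"
    using Q_cnj[OF \<phi>] by simp
  from arg_cong[OF this, of Re]
  have "(norm (Q \<phi> u))\<^sup>2 + (norm (Q \<psi> u))\<^sup>2 = 2 * Re (cinner u (Q \<psi> u))"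
    by (simp add: cinner_self)
  hence "(norm u)\<^sup>2 - (norm (Q \<phi> u))\<^sup>2 = (norm (u - Q \<psi> u))\<^sup>2"
    unfolding norm_diff_sq by simp
  hence "(norm (Q \<phi> u))\<^sup>2 \<le> (norm u)\<^sup>2"
    using zero_le_power2[of "norm (u - Q \<psi> u)"] by linarith
  thus ?thesis
    by (rule power2_le_imp_le) simp
qed

text \<open>Scaling by \<open>1 / c\<close> reduces this to \<open>Q_contraction_1\<close>. It
  provides the norm continuity of \<open>Q\<close>, which \<open>hilbert_module\<close> does not
  postulate.\<close>

lemma Q_contraction:
  assumes \<phi>: "\<phi> \<in> C0" and le: "\<And>x. norm (\<phi> x) \<le> c" and c: "c > 0"
  shows "norm (Q \<phi>) \<le> c"
proof (rule norm_blinfun_bound)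
  fix u
  have "norm (Q (\<lambda>x. complex_of_real (1 / c) * \<phi> x) u) \<le> norm u"
    using le c by (intro Q_contraction_1 C0_scale \<phi>) (simp add: norm_mult norm_divide field_simps)
  hence "norm (complex_of_real (1 / c) *\<^sub>C Q \<phi> u) \<le> norm u"
    unfolding Q_scale[OF \<phi>] by (simp add: scaleC_blinfun.rep_eq)
  hence "1 / c * norm (Q \<phi> u) \<le> norm u"
    unfolding norm_scaleC norm_of_real using c by simp
  thus "norm (Q \<phi> u) \<le> c * norm u"
    using c by (simp add: field_simps)
qed (use c in simp)

text \<open>The defining relation fixes the operator on the vectors \<open>Q \<psi> u\<close>, hence
  on their dense span and by continuity everywhere. This links the first order condition, stated
  with \<open>module_ext\<close>, to the multipliers themselves.\<close>

lemma module_ext_C0: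
  assumes \<phi>: "\<phi> \<in> C0"
  shows "module_ext Q \<phi> = Q \<phi>"
  unfolding module_ext_def
proof (rule the_equality)
  show "Q \<phi> \<in> bounded_ops \<and> (\<forall>\<psi>\<in>C0. Q \<phi> o\<^sub>L Q \<psi> = Q (\<lambda>x. \<phi> x * \<psi> x))"
    using \<phi> by (simp add: Q_bounded_op Q_mult)
  fix T assume T: "T \<in> bounded_ops \<and> (\<forall>\<psi>\<in>C0. T o\<^sub>L Q \<psi> = Q (\<lambda>x. \<phi> x * \<psi> x))"
  let ?E = "{u. blinfun_apply T u = Q \<phi> u}"
  have "csubspace ?E"
    using T Q_bounded_op[OF \<phi>]
    by (auto simp: complex_vector.subspace_def bounded_ops_def blinfun.add_right)
  moreover have "{Q \<psi> u |\<psi> u. \<psi> \<in> C0} \<subseteq> ?E"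
  proof clarify
    fix \<psi> :: "'x \<Rightarrow> complex" and u assume "\<psi> \<in> C0"
    hence "T o\<^sub>L Q \<psi> = Q \<phi> o\<^sub>L Q \<psi>"
      using T Q_mult[OF \<phi>] by simp
    thus "blinfun_apply T (Q \<psi> u) = Q \<phi> (Q \<psi> u)"
      by (metis blinfun_apply_blinfun_compose)
  qed
  ultimately have "cspan {Q \<psi> u |\<psi> u. \<psi> \<in> C0} \<subseteq> ?E"
    by (intro complex_vector.span_minimal)
  moreover have "closed ?E"
    by (intro closed_Collect_eq continuous_intros)
  ultimately have "?E = UNIV"
    using closure_minimal Q_dense by blast
  thus "T = Q \<phi>"
    by (intro blinfun_eqI) blast
qed

end

section \<open>Cutoff functions with small Lipschitz constant\<close>

text \<open>For \<delta> > 0 the function is 1 on the closed ball of radius \<open>R\<close>, falls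
  with slope \<open>\<delta>\<close> in the distance from \<open>x0\<close>, and vanishes from
  radius \<open>R + 1 / \<delta>\<close> on.\<close>

definition cutoff :: "'x::metric_space \<Rightarrow> real \<Rightarrow> real \<Rightarrow> 'x \<Rightarrow> complex" where
  "cutoff x0 R \<delta> x = complex_of_real (max 0 (min 1 (1 + \<delta> * (R - dist x0 x))))"

lemma norm_cutoff_le: "norm (cutoff x0 R \<delta> x) \<le> 1"
  and norm_one_minus_cutoff_le: "norm (1 - cutoff x0 R \<delta> x) \<le> 1"
proof -
  show "norm (cutoff x0 R \<delta> x) \<le> 1"
    unfolding cutoff_def norm_of_real by simp
  have "norm (1 - cutoff x0 R \<delta> x) = \<bar>1 - max 0 (min 1 (1 + \<delta> * (R - dist x0 x)))\<bar>"
    unfolding cutoff_def norm_of_real[where 'a=complex, symmetric] by simp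
  thus "norm (1 - cutoff x0 R \<delta> x) \<le> 1"
    by simp
qed

text \<open>Clamping to [0, 1] is 1-Lipschitz, and so is the distance from
  \<open>x0\<close>.\<close>

lemma cutoff_lipschitz:
  assumes "\<delta> \<ge> 0"
  shows "norm (cutoff x0 R \<delta> x - cutoff x0 R \<delta> y) \<le> \<delta> * dist x y"
proof -
  let ?a = "1 + \<delta> * (R - dist x0 x)" and ?b = "1 + \<delta> * (R - dist x0 y)"
  have "norm (cutoff x0 R \<delta> x - cutoff x0 R \<delta> y) = \<bar>max 0 (min 1 ?a) - max 0 (min 1 ?b)\<bar>"
    unfolding cutoff_def norm_of_real[where 'a=complex, symmetric] by simp
  also have "\<dots> \<le> \<bar>?a - ?b\<bar>"
    by linarith
  also have "?a - ?b = \<delta> * (dist x0 y - dist x0 x)"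
    by (simp add: algebra_simps)
  also have "\<bar>\<dots>\<bar> \<le> \<delta> * dist x y"
    unfolding abs_mult using assms abs_dist_diff_le[of y x0 x]
    by (auto intro!: mult_left_mono simp: dist_commute)
  finally show ?thesis .
qed

lemma cutoff_bounded_lipschitz:
  assumes "\<delta> \<ge> 0"
  shows "cutoff x0 R \<delta> \<in> bounded_lipschitz"
proof -
  have "bounded (range (cutoff x0 R \<delta>))"
    unfolding bounded_iff using norm_cutoff_le by blast
  moreover have "\<delta>-lipschitz_on UNIV (cutoff x0 R \<delta>)"
    using cutoff_lipschitz[OF assms] assms by (auto intro!: lipschitz_onI simp: dist_norm)
  ultimately show ?thesis
    unfolding bounded_lipschitz_def by blast
qed

lemma cutoff_C0:
  assumes "proper_metric_space TYPE('x)" "\<delta> > 0"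
  shows "cutoff (x0 :: 'x::metric_space) R \<delta> \<in> C0"
proof -
  have "compact (cball x0 (R + 1 / \<delta>))"
    using assms(1) by (simp add: proper_metric_space_def)
  moreover have "cutoff x0 R \<delta> x = 0" if "x \<notin> cball x0 (R + 1 / \<delta>)" for x
    using that assms(2) by (simp add: cutoff_def field_simps)
  moreover have "continuous_on UNIV (cutoff x0 R \<delta>)"
    unfolding cutoff_def by (intro continuous_intros)
  ultimately show ?thesis
    unfolding C0_def by (intro CollectI conjI allI impI exI[of _ "cball x0 (R + 1 / \<delta>)"]) simp_all
qed

text \<open>\<open>Lip\<close> is a supremum of reals, so its set of quotients must be shown
  nonempty: a noncompact space has more than one point. The lower bound allows a later
  multiplication by a constant of unknown sign.\<close>

lemma Lip_cutoff:
  assumes "proper_metric_space TYPE('x)" "\<delta> \<ge> 0"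
  shows "0 \<le> Lip (cutoff (x0 :: 'x::metric_space) R \<delta>)" "Lip (cutoff x0 R \<delta>) \<le> \<delta>"
proof -
  let ?L = "{norm (cutoff x0 R \<delta> x - cutoff x0 R \<delta> y) / dist x y |x y. x \<noteq> y}"
  have "UNIV \<noteq> {x0}"
    using assms(1) by (metis proper_metric_space_def compact_sing)
  then obtain x where "x \<noteq> x0"
    by blast
  hence mem: "norm (cutoff x0 R \<delta> x - cutoff x0 R \<delta> x0) / dist x x0 \<in> ?L"
    by blast
  have le: "l \<le> \<delta>" if "l \<in> ?L" for l
    using that cutoff_lipschitz[OF assms(2), of x0 R] by (auto simp: divide_le_eq)
  show "Lip (cutoff x0 R \<delta>) \<le> \<delta>"
    unfolding Lip_def using mem le by (intro cSup_least) blast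
  have "0 \<le> norm (cutoff x0 R \<delta> x - cutoff x0 R \<delta> x0) / dist x x0"
    by simp
  also have "\<dots> \<le> Lip (cutoff x0 R \<delta>)"
    unfolding Lip_def using le by (intro cSup_upper[OF mem] bdd_aboveI)
  finally show "0 \<le> Lip (cutoff x0 R \<delta>)" .
qed

text \<open>A ball of radius \<open>R\<close> contains a compact set off which |\<phi>| < e, so |(1
  - \<kappa>) \<phi>| \<le> e everywhere and \<open>Q_contraction\<close> applies. Only
  \<open>R\<close> depends on \<open>\<phi>\<close> and \<open>e\<close>; the slope
  \<open>\<delta>\<close> is prescribed.\<close>

lemma C0_approx_cutoff:
  assumes X: "proper_metric_space TYPE('x)" and \<phi>: "\<phi> \<in> C0" and e: "e > 0"
    and Q: "hilbert_module Q" and \<delta>: "\<delta> > 0"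
  obtains R where "norm (Q \<phi> - (Q (cutoff (x0 :: 'x::metric_space) R \<delta>) o\<^sub>L Q \<phi>)) \<le> e"
    "norm (Q \<phi> - (Q \<phi> o\<^sub>L Q (cutoff x0 R \<delta>))) \<le> e"
proof -
  obtain K where K: "compact K" "\<And>x. x \<notin> K \<Longrightarrow> norm (\<phi> x) < e"
    using \<phi> e unfolding C0_def by blast
  obtain R where R: "\<forall>x\<in>K. dist x0 x \<le> R"
    using compact_imp_bounded[OF K(1)] unfolding bounded_any_center[where a = x0] by blast
  define \<kappa> where "\<kappa> = cutoff x0 R \<delta>"
  have \<kappa>: "\<kappa> \<in> C0"
    unfolding \<kappa>_def by (rule cutoff_C0[OF X \<delta>])
  have cont: "continuous_on UNIV \<phi>" "continuous_on UNIV \<kappa>"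
    using \<phi> \<kappa> by (simp_all add: C0_def)
  have prod: "(\<lambda>x. \<kappa> x * \<phi> x) \<in> C0"
    by (intro C0_dominated[OF \<phi>] continuous_intros cont)
      (simp add: norm_mult \<kappa>_def norm_cutoff_le mult_left_le_one_le)
  have diff: "(\<lambda>x. (1 - \<kappa> x) * \<phi> x) \<in> C0"
    by (intro C0_dominated[OF \<phi>] continuous_intros cont)
      (simp add: norm_mult \<kappa>_def norm_one_minus_cutoff_le mult_left_le_one_le)
  have "norm ((1 - \<kappa> x) * \<phi> x) \<le> e" for x
  proof (cases "x \<in> K")
    case True
    hence "dist x0 x \<le> R"
      using R by blast
    hence "\<kappa> x = 1"
      using \<delta> by (simp add: \<kappa>_def cutoff_def)
    thus ?thesis
      using e by simp
  next
    case False
    have "norm ((1 - \<kappa> x) * \<phi> x) \<le> norm (\<phi> x)"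
      by (simp add: norm_mult \<kappa>_def norm_one_minus_cutoff_le mult_left_le_one_le)
    thus ?thesis
      using K(2)[OF False] by simp
  qed
  hence le: "norm (Q (\<lambda>x. (1 - \<kappa> x) * \<phi> x)) \<le> e"
    by (rule Q_contraction[OF Q diff _ e])
  \<comment> \<open>The splitting is made after multiplication by \<open>\<phi>\<close>, so that
    both summands lie in \<open>C0\<close>.\<close>
  have "Q \<phi> = Q (\<lambda>x. (1 - \<kappa> x) * \<phi> x) + Q (\<lambda>x. \<kappa> x * \<phi> x)"
    by (subst Q_add[OF Q diff prod, symmetric]) (simp add: left_diff_distrib)
  hence eq: "Q \<phi> - Q (\<lambda>x. \<kappa> x * \<phi> x) = Q (\<lambda>x. (1 - \<kappa> x) * \<phi> x)"
    by simp
  have "Q (\<lambda>x. \<kappa> x * \<phi> x) = Q \<kappa> o\<^sub>L Q \<phi>"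
    by (rule Q_mult[OF Q \<kappa> \<phi>])
  moreover have "Q (\<lambda>x. \<kappa> x * \<phi> x) = Q \<phi> o\<^sub>L Q \<kappa>"
    unfolding Q_mult[OF Q \<phi> \<kappa>, symmetric] by (simp only: mult.commute)
  ultimately show ?thesis
    using le eq by (intro that[of R]) (simp_all only: \<kappa>_def)
qed

section \<open>Decay preservation from small commutators\<close>

lemma bounded_ops_compose:
  assumes "S \<in> bounded_ops" "T \<in> bounded_ops"
  shows "S o\<^sub>L T \<in> bounded_ops"
  using assms by (simp add: bounded_ops_def)

text \<open>The commutator bound is uniform in \<open>R\<close>: first \<open>\<delta>\<close> is
  chosen to make the commutator small, then \<open>R\<close> to make the cutoff nearly the identity
  on the given multiplier.\<close>

lemma decay_preserving_if_small_commutators: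
  fixes QH :: "('x::metric_space \<Rightarrow> complex) \<Rightarrow> ('h::complex_hilbert \<Rightarrow>\<^sub>L 'h)"
    and QK :: "('x \<Rightarrow> complex) \<Rightarrow> ('k::complex_hilbert \<Rightarrow>\<^sub>L 'k)"
  assumes X: "proper_metric_space TYPE('x)"
    and QH: "hilbert_module QH" and QK: "hilbert_module QK"
    and S: "S \<in> bounded_ops"
    and comm: "\<And>x0 R \<delta>. \<delta> > 0 \<Longrightarrow>
      norm ((S o\<^sub>L QH (cutoff x0 R \<delta>)) - (QK (cutoff x0 R \<delta>) o\<^sub>L S)) \<le> c * \<delta>"
  shows "decay_preserving QH QK S"
proof -
  \<comment> \<open>Any base point will do; all cutoffs are centred at it.\<close>
  fix x0 :: 'x
  let ?comm = "\<lambda>R \<delta>. (S o\<^sub>L QH (cutoff x0 R \<delta>)) - (QK (cutoff x0 R \<delta>) o\<^sub>L S)"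
  have small: "\<exists>\<eta>>0. \<exists>\<delta>>0. norm S * \<eta> + c * \<delta> * a < e" if "e > 0" "a \<ge> 0" for e a :: real
  proof -
    \<comment> \<open>Each of the two terms gets half of \<open>e\<close>. The summands 1 keep the
      denominators positive, and the absolute value allows for a negative \<open>c\<close>.\<close>
    define \<delta> where "\<delta> = e / (2 * (\<bar>c\<bar> * a + 1))"
    define \<eta> where "\<eta> = e / (2 * (norm S + 1))"
    have pos: "0 < \<bar>c\<bar> * a + 1" "0 < norm S + 1"
      using that by (simp_all add: add_nonneg_pos)
    hence "\<delta> > 0" "\<eta> > 0"
      using that by (simp_all add: \<delta>_def \<eta>_def)
    moreover have "norm S * \<eta> < e / 2"
      using pos that by (simp add: \<eta>_def field_simps)
    moreover have "c * \<delta> * a \<le> \<bar>c\<bar> * \<delta> * a"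
      using \<open>\<delta> > 0\<close> that by (intro mult_right_mono) auto
    moreover have "\<bar>c\<bar> * \<delta> * a \<le> e / 2"
      using pos that by (simp add: \<delta>_def field_simps)
    ultimately show ?thesis
      by (intro exI[of _ \<eta>] conjI exI[of _ \<delta>]) linarith+
  qed
  show ?thesis
    unfolding decay_preserving_def multiplier_algebra_def
  proof (intro conjI ballI; elim imageE; clarify)
    fix \<phi> :: "'x \<Rightarrow> complex" assume \<phi>: "\<phi> \<in> C0"
    show "S o\<^sub>L QH \<phi> \<in> closure (cspan {N o\<^sub>L T |N T. N \<in> QK ` C0 \<and> T \<in> bounded_ops})"
      unfolding closure_approachable
    proof (intro allI impI)
      fix e :: real assume "e > 0"
      then obtain \<eta> \<delta> where \<delta>: "\<eta> > 0" "\<delta> > 0" "norm S * \<eta> + c * \<delta> * norm (QH \<phi>) < e"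
        using small[of e "norm (QH \<phi>)"] by auto
      obtain R where R: "norm (QH \<phi> - (QH (cutoff x0 R \<delta>) o\<^sub>L QH \<phi>)) \<le> \<eta>"
        by (rule C0_approx_cutoff[OF X \<phi> \<delta>(1) QH \<delta>(2)])
      let ?y = "QK (cutoff x0 R \<delta>) o\<^sub>L (S o\<^sub>L QH \<phi>)"
      have "?y \<in> cspan {N o\<^sub>L T |N T. N \<in> QK ` C0 \<and> T \<in> bounded_ops}"
        using cutoff_C0[OF X \<delta>(2)] bounded_ops_compose[OF S Q_bounded_op[OF QH \<phi>]]
        by (intro complex_vector.span_base) blast
      moreover have "dist ?y (S o\<^sub>L QH \<phi>) < e"
      proof -
        \<comment> \<open>The product of \<open>S\<close>, the cutoff and \<open>QH \<phi>\<close>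
          is subtracted and added: one term holds the cutoff error, the other the
          commutator.\<close>
        have eq: "(S o\<^sub>L QH \<phi>) - ?y
            = (S o\<^sub>L (QH \<phi> - (QH (cutoff x0 R \<delta>) o\<^sub>L QH \<phi>))) + (?comm R \<delta> o\<^sub>L QH \<phi>)"
          by (rule blinfun_eqI) (simp add: blinfun.diff_left blinfun.add_left blinfun.diff_right)
        have "norm ((S o\<^sub>L QH \<phi>) - ?y)
            \<le> norm S * norm (QH \<phi> - (QH (cutoff x0 R \<delta>) o\<^sub>L QH \<phi>)) + norm (?comm R \<delta>) * norm (QH \<phi>)"
          unfolding eq by (intro norm_triangle_le add_mono norm_blinfun_compose)
        also have "\<dots> \<le> norm S * \<eta> + c * \<delta> * norm (QH \<phi>)"
          using R comm[OF \<delta>(2)] by (intro add_mono mult_left_mono mult_right_mono) auto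
        also note \<delta>(3)
        finally show ?thesis
          by (simp add: dist_norm norm_minus_commute)
      qed
      ultimately show "\<exists>y\<in>cspan {N o\<^sub>L T |N T. N \<in> QK ` C0 \<and> T \<in> bounded_ops}. dist y (S o\<^sub>L QH \<phi>) < e"
        by blast
    qed
    show "QK \<phi> o\<^sub>L S \<in> closure (cspan {T o\<^sub>L M |T M. T \<in> bounded_ops \<and> M \<in> QH ` C0})"
      unfolding closure_approachable
    proof (intro allI impI)
      fix e :: real assume "e > 0"
      then obtain \<eta> \<delta> where \<delta>: "\<eta> > 0" "\<delta> > 0" "norm S * \<eta> + c * \<delta> * norm (QK \<phi>) < e"
        using small[of e "norm (QK \<phi>)"] by auto
      obtain R where R: "norm (QK \<phi> - (QK \<phi> o\<^sub>L QK (cutoff x0 R \<delta>))) \<le> \<eta>"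
        by (rule C0_approx_cutoff[OF X \<phi> \<delta>(1) QK \<delta>(2)])
      let ?y = "(QK \<phi> o\<^sub>L S) o\<^sub>L QH (cutoff x0 R \<delta>)"
      have "?y \<in> cspan {T o\<^sub>L M |T M. T \<in> bounded_ops \<and> M \<in> QH ` C0}"
        using cutoff_C0[OF X \<delta>(2)] bounded_ops_compose[OF Q_bounded_op[OF QK \<phi>] S]
        by (intro complex_vector.span_base) blast
      moreover have "dist ?y (QK \<phi> o\<^sub>L S) < e"
      proof -
        \<comment> \<open>The mirror image: the cutoff now stands to the right of \<open>S\<close>,
          and commuting it to the left brings it next to \<open>QK \<phi>\<close>.\<close>
        have eq: "?y - (QK \<phi> o\<^sub>L S)
            = (QK \<phi> o\<^sub>L ?comm R \<delta>) - ((QK \<phi> - (QK \<phi> o\<^sub>L QK (cutoff x0 R \<delta>))) o\<^sub>L S)"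
          by (rule blinfun_eqI) (simp add: blinfun.diff_left blinfun.diff_right)
        have "norm (?y - (QK \<phi> o\<^sub>L S))
            \<le> norm (QK \<phi>) * norm (?comm R \<delta>) + norm (QK \<phi> - (QK \<phi> o\<^sub>L QK (cutoff x0 R \<delta>))) * norm S"
          unfolding eq by (intro norm_triangle_le_diff add_mono norm_blinfun_compose)
        also have "\<dots> \<le> norm (QK \<phi>) * (c * \<delta>) + \<eta> * norm S"
          using R comm[OF \<delta>(2)] by (intro add_mono mult_left_mono mult_right_mono) auto
        also have "\<dots> < e"
          using \<delta>(3) by (simp add: ac_simps)
        finally show ?thesis
          by (simp add: dist_norm)
      qed
      ultimately show "\<exists>y\<in>cspan {T o\<^sub>L M |T M. T \<in> bounded_ops \<and> M \<in> QH ` C0}. dist y (QK \<phi> o\<^sub>L S) < e"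
        by blast
    qed
  qed
qed

text \<open>Bijectivity belongs to the conclusion so that \<open>inv_into\<close> is the genuine
  inverse of \<Delta> + 1 and \<open>S\<close> is the operator meant.\<close>

theorem lemma8p2:
  fixes QH :: "('x::metric_space \<Rightarrow> complex) \<Rightarrow> ('h::complex_hilbert \<Rightarrow>\<^sub>L 'h)"
    and QK :: "('x \<Rightarrow> complex) \<Rightarrow> ('k::complex_hilbert \<Rightarrow>\<^sub>L 'k)"
    and D :: "'h set" and d :: "'h \<Rightarrow> 'k"
  assumes "proper_metric_space TYPE('x)"
    and "hilbert_module QH" and "hilbert_module QK"
    and "closed_densely_defined D d"
    and "first_order QH QK D d"
  shows "bij_betw (\<lambda>v. laplace D d v + v) (laplace_dom D d) UNIV \<and>
    (\<exists>S \<in> bounded_ops.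
       (\<forall>f. blinfun_apply S f = d (inv_into (laplace_dom D d) (\<lambda>v. laplace D d v + v) f)) \<and>
       decay_preserving QH QK S)"
proof -
  note X = assms(1) and QH = assms(2) and QK = assms(3) and cdd = assms(4)
  obtain S where S: "S \<in> bounded_ops" "\<And>f. blinfun_apply S f = d (resolvent D d f)"
    by (rule d_resolvent_operator[OF cdd]) (rule that)
  obtain C where C: "\<And>\<phi> u v. \<phi> \<in> bounded_lipschitz \<Longrightarrow> u \<in> adj_dom D d \<Longrightarrow> v \<in> D \<Longrightarrow>
      norm (cinner (adj D d u) (module_ext QH \<phi> v) - cinner u (module_ext QK \<phi> (d v)))
        \<le> C * Lip \<phi> * norm u * norm v"
    using assms(5) unfolding first_order_def by (elim conjE exE) (rule that, blast)
  have "norm ((S o\<^sub>L QH (cutoff x0 R \<delta>)) - (QK (cutoff x0 R \<delta>) o\<^sub>L S)) \<le> 3 * \<bar>C\<bar> * \<delta>"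
    if \<delta>: "\<delta> > 0" for x0 R \<delta>
  proof (rule norm_blinfun_bound)
    fix f
    define \<kappa> where "\<kappa> = cutoff x0 R \<delta>"
    have \<kappa>: "\<kappa> \<in> C0" "\<kappa> \<in> bounded_lipschitz" "(\<lambda>x. cnj (\<kappa> x)) = \<kappa>"
      using cutoff_C0[OF X \<delta>] cutoff_bounded_lipschitz[of \<delta>] \<delta> by (auto simp: \<kappa>_def cutoff_def)
    \<comment> \<open>The constant \<open>C\<close> may be negative, so its absolute value is taken;
      the estimate uses that \<open>Lip \<kappa>\<close> is nonnegative.\<close>
    have "C * Lip \<kappa> \<le> \<bar>C\<bar> * \<delta>"
      using Lip_cutoff[OF X, of \<delta> x0 R] \<delta> unfolding \<kappa>_def by (intro mult_mono) auto
    hence "C * Lip \<kappa> * norm u * norm v \<le> \<bar>C\<bar> * \<delta> * norm u * norm v" for u :: 'k and v :: 'h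
      by (intro mult_right_mono) auto
    hence "norm (cinner (adj D d u) (QH \<kappa> v) - cinner u (QK \<kappa> (d v))) \<le> \<bar>C\<bar> * \<delta> * norm u * norm v"
      if "u \<in> adj_dom D d" "v \<in> D" for u v
      using C[OF \<kappa>(2) that] order_trans
      unfolding module_ext_C0[OF QH \<kappa>(1)] module_ext_C0[OF QK \<kappa>(1)] by blast
    \<comment> \<open>Since \<open>\<kappa>\<close> is real, \<open>Q_cnj\<close> gives the symmetry
      of both multipliers, and \<open>commutator_resolvent\<close> applies with \<epsilon> = |C|
      \<delta>.\<close>
    hence "norm (d (resolvent D d (QH \<kappa> f)) - QK \<kappa> (d (resolvent D d f))) \<le> 3 * (\<bar>C\<bar> * \<delta>) * norm f"
      using Q_cnj[OF QH \<kappa>(1)] Q_cnj[OF QK \<kappa>(1)] \<delta> unfolding \<kappa>(3)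
      by (intro commutator_resolvent[OF cdd]) auto
    thus "norm (((S o\<^sub>L QH (cutoff x0 R \<delta>)) - (QK (cutoff x0 R \<delta>) o\<^sub>L S)) f) \<le> 3 * \<bar>C\<bar> * \<delta> * norm f"
      by (simp add: blinfun.diff_left S(2) \<kappa>_def mult.assoc)
  qed (use \<delta> in simp)
  from decay_preserving_if_small_commutators[OF X QH QK S(1) this]
  show ?thesis
    using bij_laplace_plus_id[OF cdd] S(1) S(2)[unfolded resolvent_def[OF cdd]]
    by (intro conjI bexI[of _ S] allI)
qed

end
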